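(* $\mathfrak{st}\leq\mathfrak{pp}$.
   Context: A compactification $\alpha\omega$ of the countable discrete space $\omega$ is a compact Hausdorff space containing $\omega$ as a dense subspace. $\alpha\omega\leq\gamma\omega$ means there is a continuous surjection $f:\gamma\omega\to\alpha\omega$ whose restriction to $\omega$ is the identity; $\alpha\omega\simeq\gamma\omega$ means such an $f$ can be chosen to be a homeomorphism. Modulo $\simeq$, compactifications of $\omega$ ordered by $\leq$ form a complete upper semilattice with largest element the Stone–Čech compactification $\beta\omega$; $\sup$ is taken in it. $C_{\alpha\omega}$ denotes the set of bounded functions $\omega\to\mathbb{R}$ that extend continuously over $\alpha\omega$; it determines $\alpha\omega$ up to $\simeq$, and every subring of the ring of bounded functions on $\omega$ that is closed in the uniform norm, contains all constants and generates the topology of $\omega$ is of this form. $\mathrm{M}(\omega)$ is the set of all metrics on $\omega$ compatible with the discrete topology. For $d\in\mathrm{M}(\omega)$, the Smirnov compactification $u_d\omega$ is the compactification with $C_{u_d\omega}=U^*_d(\omega)$, the ring of all bounded uniformly continuous functions from $(\omega,d)$ to $\mathbb{R}$. $\mathrm{M}'(\omega)$ is the set of $d\in\mathrm{M}(\omega)$ with $\beta\omega\not\simeq u_d\omega$. For $d_1,d_2\in\mathrm{M}(\omega)$, $d_1\preceq d_2$ means $U^*_{d_1}(\omega)\subseteq U^*_{d_2}(\omega)$ (equivalently $u_{d_1}\omega\leq u_{d_2}\omega$). $\mathfrak{st}$ is the smallest cardinality of a set $D\subseteq\mathrm{M}'(\omega)$ that is well-ordered by $\preceq$ and satisfies $\beta\omega\simeq\sup\{u_d\omega: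 d\in D\}$. An ultrafilter means a non-principal ultrafilter on $\omega$. A family $\mathcal{F}\subseteq\mathcal{U}$ generates the ultrafilter $\mathcal{U}$ if every $X\in\mathcal{U}$ has a subset $Y\in\mathcal{F}$. For $X,Y\subseteq\omega$, $X\subseteq^*Y$ means $X\setminus Y$ is finite. For an uncountable regular cardinal $\kappa$, an ultrafilter is a simple p${}_\kappa$-point if it is generated by a sequence of length $\kappa$ that is decreasing with respect to $\subseteq^*$. $\mathfrak{pp}$ is the smallest cardinal $\kappa$ for which a simple p${}_\kappa$-point exists. Convention: if no object of the required kind exists, the cardinal being defined is $\infty$, and $\lambda<\infty$ for every cardinal $\lambda$. *)

theory Defs
  imports "HOL-Analysis.Analysis"
begin

unbundle cardinal_syntax
no_notation elt_set_eq (infix \<open>=o\<close> 50)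

section \<open>Compactifications of \<open>\<omega>\<close>\<close>

text \<open>
  A compactification of \<open>\<omega> = (UNIV :: nat set)\<close> is given by a space together with the embedding of
  \<open>\<omega>\<close> into it. ``The identity on \<open>\<omega>\<close>'' thus becomes compatibility with the two embeddings.
\<close>

type_synonym 'a cptf = "'a topology \<times> (nat \<Rightarrow> 'a)"

definition is_cptf :: "'a cptf \<Rightarrow> bool" where
  "is_cptf \<alpha> \<longleftrightarrow>
     compact_space (fst \<alpha>) \<and> Hausdorff_space (fst \<alpha>) \<and>
     embedding_map (discrete_topology UNIV) (fst \<alpha>) (snd \<alpha>) \<and>
     fst \<alpha> closure_of range (snd \<alpha>) = topspace (fst \<alpha>)"

definition cptf_le :: "'a cptf \<Rightarrow> 'b cptf \<Rightarrow> bool" where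
  "cptf_le \<alpha> \<gamma> \<longleftrightarrow>
     (\<exists>f. continuous_map (fst \<gamma>) (fst \<alpha>) f \<and> f ` topspace (fst \<gamma>) = topspace (fst \<alpha>) \<and>
          (\<forall>n. f (snd \<gamma> n) = snd \<alpha> n))"

definition cptf_equiv :: "'a cptf \<Rightarrow> 'b cptf \<Rightarrow> bool" where
  "cptf_equiv \<alpha> \<gamma> \<longleftrightarrow>
     (\<exists>f. homeomorphic_map (fst \<gamma>) (fst \<alpha>) f \<and> (\<forall>n. f (snd \<gamma> n) = snd \<alpha> n))"

definition ext_functions :: "'a cptf \<Rightarrow> (nat \<Rightarrow> real) set" where
  "ext_functions \<alpha> =
     {f. bounded (range f) \<and>
         (\<exists>g. continuous_map (fst \<alpha>) euclideanreal g \<and> (\<forall>n. g (snd \<alpha> n) = f n))}"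

text \<open>
  To speak about all compactifications at once we fix a type of points. No compactification is lost
  (up to equivalence): a point \<open>p\<close> of \<open>\<alpha>\<omega>\<close> can be replaced by the functional that sends
  \<open>f \<in> C\<^bsub>\<alpha>\<omega>\<^esub>\<close> to the value at \<open>p\<close> of the extension of \<open>f\<close>; see \<open>cptf_representable\<close>.
\<close>

type_synonym point = "(nat \<Rightarrow> real) \<Rightarrow> real"

lemma cptf_representable:
  fixes \<alpha> :: "'a cptf"
  assumes "is_cptf \<alpha>"
  shows "\<exists>\<gamma> :: point cptf. is_cptf \<gamma> \<and> cptf_equiv \<gamma> \<alpha>"
proof -
  obtain X e where \<alpha>: "\<alpha> = (X, e)"
    by (cases \<alpha>)
  have cX: "compact_space X" and hX: "Hausdorff_space X"
    and emb: "embedding_map (discrete_topology UNIV) X e"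
    and dense: "X closure_of range e = topspace X"
    using assms by (auto simp: is_cptf_def \<alpha>)
  have e_in: "e n \<in> topspace X" for n
    using homeomorphic_imp_surjective_map[OF emb[unfolded embedding_map_def]] by auto
  define E where "E f = (SOME g. continuous_map X euclideanreal g \<and> (\<forall>n. g (e n) = f n))"
    for f :: "nat \<Rightarrow> real"
  define C where "C = ext_functions \<alpha>"
  have E: "continuous_map X euclideanreal (E f) \<and> (\<forall>n. E f (e n) = f n)" if "f \<in> C" for f
  proof -
    have "\<exists>g. continuous_map X euclideanreal g \<and> (\<forall>n. g (e n) = f n)"
      using that by (auto simp: C_def ext_functions_def \<alpha>)
    then show ?thesis
      unfolding E_def by (rule someI_ex)
  qed
  define h :: "'a \<Rightarrow> point" where "h p = (\<lambda>f. if f \<in> C then E f p else 0)" for p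
  let ?P = "product_topology (\<lambda>_. euclideanreal) (UNIV :: (nat \<Rightarrow> real) set)"
  have "continuous_map X euclideanreal (\<lambda>p. h p f)" for f
    using E[of f] by (cases "f \<in> C") (auto simp: h_def eta_contract_eq)
  then have cont: "continuous_map X ?P h"
    by (simp add: continuous_map_componentwise_UNIV)
  have inj: "inj_on h (topspace X)"
  proof (rule inj_onI, rule ccontr)
    fix p q
    assume pq: "p \<in> topspace X" "q \<in> topspace X" "h p = h q" "p \<noteq> q"
    have "completely_regular_space X"
      using cX hX by (simp add: compact_Hausdorff_or_regular_imp_normal_space
          normal_imp_completely_regular_space)
    moreover have "closedin X {q}"
      using hX pq by (simp add: closedin_Hausdorff_singleton)
    ultimately obtain g where g: "continuous_map X (top_of_set {0..1::real}) g" "g p = 0" "g q = 1"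
      unfolding completely_regular_space_def using pq by (force dest: spec[of _ "{q}"])
    then have gc: "continuous_map X euclideanreal g" and gb: "g ` topspace X \<subseteq> {0..1}"
      by (auto simp: continuous_map_in_subtopology)
    define f where "f = (\<lambda>n. g (e n))"
    have "range f \<subseteq> {0..1}"
      using gb e_in by (auto simp: f_def)
    then have "bounded (range f)"
      using bounded_closed_interval bounded_subset by blast
    then have fC: "f \<in> C"
      using gc by (auto simp: C_def ext_functions_def \<alpha> f_def)
    have "E f x = g x" if "x \<in> topspace X" for x
    proof (rule forall_in_closure_of_eq[where X = X and Y = euclideanreal and f = "E f"])
      show "x \<in> X closure_of range e" using that dense by simp
      show "E f y = g y" if "y \<in> range e" for y
        using E[OF fC] that by (auto simp: f_def)
    qed (use E[OF fC] gc in auto)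
    then have "h p f = 0" "h q f = 1"
      using pq(1,2) g(2,3) fC by (simp_all add: h_def)
    then show False using \<open>h p = h q\<close> by simp
  qed
  define Y where "Y = subtopology ?P (h ` topspace X)"
  have "Hausdorff_space ?P"
    by (simp add: Hausdorff_space_product_topology)
  then have "embedding_map X ?P h"
    using continuous_imp_embedding_map cX cont inj by blast
  then have hom: "homeomorphic_map X Y h"
    by (simp add: embedding_map_def Y_def)
  then have hsp: "X homeomorphic_space Y"
    using homeomorphic_map_imp_homeomorphic_space by blast
  have "is_cptf (Y, h \<circ> e)"
  proof -
    have "compact_space Y" "Hausdorff_space Y"
      using cX hX homeomorphic_compact_space[OF hsp] homeomorphic_Hausdorff_space[OF hsp] by simp_all
    moreover have "embedding_map X Y h"
      using hom surjective_embedding_map[of X Y h] by simp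
    then have "embedding_map (discrete_topology UNIV) Y (h \<circ> e)"
      by (rule embedding_map_compose[OF emb])
    moreover have "Y closure_of range (h \<circ> e) = topspace Y"
      using homeomorphic_map_closure_of[OF hom, of "range e"] e_in dense
        homeomorphic_imp_surjective_map[OF hom]
      by (auto simp: image_comp image_subset_iff)
    ultimately show ?thesis
      by (simp add: is_cptf_def)
  qed
  moreover have "cptf_equiv (Y, h \<circ> e) \<alpha>"
    using hom by (auto simp: cptf_equiv_def \<alpha>)
  ultimately show ?thesis by blast
qed

text \<open>
  The following are determined only up to \<^const>\<open>cptf_equiv\<close>, which is why they are given by \<open>SOME\<close>.
\<close>

definition is_cptf_sup :: "point cptf set \<Rightarrow> point cptf \<Rightarrow> bool" where
  "is_cptf_sup A \<sigma> \<longleftrightarrow>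
     is_cptf \<sigma> \<and> (\<forall>\<alpha>\<in>A. cptf_le \<alpha> \<sigma>) \<and>
     (\<forall>\<gamma> :: point cptf. is_cptf \<gamma> \<and> (\<forall>\<alpha>\<in>A. cptf_le \<alpha> \<gamma>) \<longrightarrow> cptf_le \<sigma> \<gamma>)"

definition cptf_sup :: "point cptf set \<Rightarrow> point cptf" where
  "cptf_sup A = (SOME \<sigma>. is_cptf_sup A \<sigma>)"

definition stone_cech :: "point cptf" where
  "stone_cech = (SOME \<beta>. is_cptf \<beta> \<and> (\<forall>\<alpha> :: point cptf. is_cptf \<alpha> \<longrightarrow> cptf_le \<alpha> \<beta>))"

section \<open>Metrics on \<open>\<omega>\<close>\<close>

definition metrics :: "(nat \<Rightarrow> nat \<Rightarrow> real) set" where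
  "metrics = {d. Metric_space UNIV d \<and> Metric_space.mtopology UNIV d = discrete_topology UNIV}"

definition bdd_unif_cont :: "(nat \<Rightarrow> nat \<Rightarrow> real) \<Rightarrow> (nat \<Rightarrow> real) set" where
  "bdd_unif_cont d =
     {f. bounded (range f) \<and> uniformly_continuous_map (metric (UNIV, d)) euclidean_metric f}"

definition smirnov :: "(nat \<Rightarrow> nat \<Rightarrow> real) \<Rightarrow> point cptf" where
  "smirnov d = (SOME \<alpha>. is_cptf \<alpha> \<and> ext_functions \<alpha> = bdd_unif_cont d)"

definition metrics' :: "(nat \<Rightarrow> nat \<Rightarrow> real) set" where
  "metrics' = {d \<in> metrics. \<not> cptf_equiv stone_cech (smirnov d)}"

definition metric_le :: "(nat \<Rightarrow> nat \<Rightarrow> real) \<Rightarrow> (nat \<Rightarrow> nat \<Rightarrow> real) \<Rightarrow> bool" where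
  "metric_le d1 d2 \<longleftrightarrow> bdd_unif_cont d1 \<subseteq> bdd_unif_cont d2"

section \<open>Least cardinals, possibly infinity\<close>

text \<open>
  Cardinals are represented, up to \<open>=o\<close>, by relations satisfying \<^const>\<open>Card_order\<close>, as in the theory
  \<^theory>\<open>HOL.BNF_Cardinal_Order_Relation\<close>. The value \<open>Infinity\<close> lies above all of them.
\<close>

datatype 'a ext_card = Cardinal "'a rel" | Infinity

fun ext_card_le :: "'a ext_card \<Rightarrow> 'b ext_card \<Rightarrow> bool" where
  "ext_card_le (Cardinal r) (Cardinal s) \<longleftrightarrow> r \<le>o s"
| "ext_card_le Infinity (Cardinal s) \<longleftrightarrow> False"
| "ext_card_le x Infinity \<longleftrightarrow> True"

definition least_card :: "('a rel \<Rightarrow> bool) \<Rightarrow> 'a ext_card" where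
  "least_card P =
     (if \<exists>r. Card_order r \<and> P r
      then Cardinal (SOME r. Card_order r \<and> P r \<and> (\<forall>s. Card_order s \<and> P s \<longrightarrow> r \<le>o s))
      else Infinity)"

lemma least_card_works:
  assumes "Card_order r" "P r"
  obtains m where "least_card P = Cardinal m" "Card_order m" "P m"
    "\<And>s. Card_order s \<Longrightarrow> P s \<Longrightarrow> m \<le>o s"
proof -
  define Q where "Q = (\<lambda>m. Card_order m \<and> P m \<and> (\<forall>s. Card_order s \<and> P s \<longrightarrow> m \<le>o s))"
  have "\<exists>m. Q m"
    using exists_minim_Card_order[of "{r. Card_order r \<and> P r}"] assms unfolding Q_def by blast
  then have Q: "Q (SOME m. Q m)"
    by (rule someI_ex)
  have ex: "\<exists>r. Card_order r \<and> P r"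
    using assms by blast
  have "least_card P = Cardinal (SOME m. Q m)"
    unfolding least_card_def Q_def by (rule if_P[OF ex])
  then show ?thesis
    by (rule that) (use Q in \<open>unfold Q_def, blast+\<close>)
qed

section \<open>The cardinal \<open>\<ss>\<tt>\<close>\<close>

definition st_family :: "(nat \<Rightarrow> nat \<Rightarrow> real) set \<Rightarrow> bool" where
  "st_family D \<longleftrightarrow>
     D \<subseteq> metrics' \<and>
     well_order_on D {(d1, d2). d1 \<in> D \<and> d2 \<in> D \<and> metric_le d1 d2} \<and>
     cptf_equiv stone_cech (cptf_sup (smirnov ` D))"

definition st :: "(nat \<Rightarrow> nat \<Rightarrow> real) ext_card" where
  "st = least_card (\<lambda>r. \<exists>D. st_family D \<and> r =o |D| )"

section \<open>The cardinal \<open>\<pp>\<pp>\<close>\<close>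

definition nonprincipal_ultrafilter :: "nat set set \<Rightarrow> bool" where
  "nonprincipal_ultrafilter U \<longleftrightarrow>
     {} \<notin> U \<and>
     (\<forall>X\<in>U. \<forall>Y. X \<subseteq> Y \<longrightarrow> Y \<in> U) \<and>
     (\<forall>X\<in>U. \<forall>Y\<in>U. X \<inter> Y \<in> U) \<and>
     (\<forall>X. X \<in> U \<or> - X \<in> U) \<and>
     (\<forall>n. {n} \<notin> U)"

definition generates :: "nat set set \<Rightarrow> nat set set \<Rightarrow> bool" where
  "generates F U \<longleftrightarrow> F \<subseteq> U \<and> (\<forall>X\<in>U. \<exists>Y\<in>F. Y \<subseteq> X)"

definition almost_subset :: "nat set \<Rightarrow> nat set \<Rightarrow> bool" where
  "almost_subset X Y \<longleftrightarrow> finite (X - Y)"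

text \<open>
  A sequence of length \<open>\<kappa>\<close> is a function on \<^term>\<open>Field \<kappa>\<close>, which is well-ordered by \<open>\<kappa>\<close> in the
  order type of the initial ordinal \<open>\<kappa>\<close>.
\<close>

definition simple_p_point :: "'k rel \<Rightarrow> nat set set \<Rightarrow> bool" where
  "simple_p_point \<kappa> U \<longleftrightarrow>
     nonprincipal_ultrafilter U \<and>
     (\<exists>T :: 'k \<Rightarrow> nat set.
        (\<forall>i j. (i, j) \<in> \<kappa> \<longrightarrow> almost_subset (T j) (T i)) \<and> generates (T ` Field \<kappa>) U)"

definition admits_simple_p_point :: "'k rel \<Rightarrow> bool" where
  "admits_simple_p_point \<kappa> \<longleftrightarrow>
     Card_order \<kappa> \<and> natLeq <o \<kappa> \<and> regularCard \<kappa> \<and> (\<exists>U. simple_p_point \<kappa> U)"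

text \<open>
  It suffices to look for \<open>\<kappa>\<close> among the cardinals up to the continuum, i.e. those represented on the
  type \<^typ>\<open>nat set\<close>: if \<open>\<kappa>\<close> is larger, then some set occurs cofinally often in the sequence, and it
  is almost contained in every element of the ultrafilter, which is impossible.
\<close>

lemma admits_simple_p_point_le_continuum:
  fixes \<kappa> :: "'k rel"
  assumes "admits_simple_p_point \<kappa>"
  shows "\<kappa> \<le>o |UNIV :: nat set set|"
proof (rule ccontr)
  have co: "Card_order \<kappa>" and unc: "natLeq <o \<kappa>" and reg: "regularCard \<kappa>"
    using assms by (auto simp: admits_simple_p_point_def)
  have wo: "Well_order \<kappa>"
    using co by (simp add: card_order_on_def)
  assume "\<not> \<kappa> \<le>o |UNIV :: nat set set|"
  then have small: "|UNIV :: nat set set| <o \<kappa>"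
    using wo card_of_Well_order not_ordLeq_iff_ordLess by blast
  obtain U T where U: "nonprincipal_ultrafilter U"
    and dec: "\<And>i j. (i, j) \<in> \<kappa> \<Longrightarrow> almost_subset (T j) (T i)"
    and gen: "generates (T ` Field \<kappa>) U"
    using assms by (auto simp: admits_simple_p_point_def simple_p_point_def)
  have ci: "Cinfinite \<kappa>"
    using co cinfinite_mono[OF ordLess_imp_ordLeq[OF unc]] natLeq_cinfinite by simp
  have "\<exists>A. |{i \<in> Field \<kappa>. T i = A}| =o \<kappa>"
  proof (rule ccontr)
    assume neg: "\<nexists>A. |{i \<in> Field \<kappa>. T i = A}| =o \<kappa>"
    have lt: "\<forall>A\<in>UNIV. |{i \<in> Field \<kappa>. T i = A}| <o \<kappa>"
    proof
      fix A
      have "|{i \<in> Field \<kappa>. T i = A}| \<le>o \<kappa>"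
        by (rule ordLeq_ordIso_trans[OF card_of_mono1 card_of_Field_ordIso[OF co]]) auto
      moreover have "\<not> |{i \<in> Field \<kappa>. T i = A}| =o \<kappa>"
        using neg by (rule contrapos_nn) (rule exI)
      ultimately show "|{i \<in> Field \<kappa>. T i = A}| <o \<kappa>"
        unfolding ordLeq_iff_ordLess_or_ordIso by (simp only: simp_thms)
    qed
    have "|\<Union>A\<in>UNIV. {i \<in> Field \<kappa>. T i = A}| <o \<kappa>"
      using card_of_UNION_ordLess_infinite_Field_regularCard[OF reg ci small lt] .
    moreover have "(\<Union>A\<in>UNIV. {i \<in> Field \<kappa>. T i = A}) = Field \<kappa>"
      by auto
    ultimately have "|Field \<kappa>| <o \<kappa>"
      by simp
    then show False
      using card_of_Field_ordIso[OF co] by (rule not_ordLess_ordIso[THEN notE])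
  qed
  then obtain A where A: "|{i \<in> Field \<kappa>. T i = A}| =o \<kappa>" ..
  have all: "almost_subset A X" if X: "X \<in> U" for X
  proof -
    obtain j where j: "j \<in> Field \<kappa>" "T j \<subseteq> X"
      using gen X unfolding generates_def by blast
    have "\<exists>i\<in>Field \<kappa>. T i = A \<and> (j, i) \<in> \<kappa>"
    proof (rule ccontr)
      assume neg: "\<not> ?thesis"
      have "{i \<in> Field \<kappa>. T i = A} \<subseteq> underS \<kappa> j"
      proof
        fix i assume i: "i \<in> {i \<in> Field \<kappa>. T i = A}"
        with neg have "(j, i) \<notin> \<kappa>" by auto
        moreover have "(i, j) \<in> \<kappa> \<or> (j, i) \<in> \<kappa>"
          using wo i j wo_rel.TOTALS[of \<kappa>] by (auto simp: wo_rel_def)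
        ultimately show "i \<in> underS \<kappa> j"
          using i by (auto simp: underS_def)
      qed
      then have "|{i \<in> Field \<kappa>. T i = A}| \<le>o |underS \<kappa> j|"
        by (rule card_of_mono1)
      then have "|{i \<in> Field \<kappa>. T i = A}| <o \<kappa>"
        using card_of_underS[OF co j(1)] by (rule ordLeq_ordLess_trans)
      then show False
        using A by (rule not_ordLess_ordIso[THEN notE])
    qed
    then have "almost_subset A (T j)"
      using dec by blast
    then show ?thesis
      using j(2) finite_subset[of "A - X" "A - T j"] by (auto simp: almost_subset_def)
  qed
  have "A \<in> U"
  proof -
    have "Field \<kappa> \<noteq> {}"
      using ci by (auto simp: cinfinite_def)
    moreover have "|{i \<in> Field \<kappa>. T i = A}| =o |Field \<kappa>|"
      using A ordIso_symmetric[OF card_of_Field_ordIso[OF co]] by (rule ordIso_transitive)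
    ultimately have "{i \<in> Field \<kappa>. T i = A} \<noteq> {}"
      using card_of_ordIso_finite[of "{i \<in> Field \<kappa>. T i = A}" "Field \<kappa>"] ci
      by (metis cinfinite_def finite.emptyI)
    then show ?thesis using gen by (auto simp: generates_def)
  qed
  have inter: "X \<inter> Y \<in> U" if "X \<in> U" "Y \<in> U" for X Y
    using U that by (simp add: nonprincipal_ultrafilter_def)
  have compl: "X \<in> U \<or> - X \<in> U" for X
    using U by (simp add: nonprincipal_ultrafilter_def)
  have fin: "F \<notin> U" if "finite F" for F
    using that
  proof (induction F)
    case empty
    then show ?case using U by (simp add: nonprincipal_ultrafilter_def)
  next
    case (insert x F)
    show ?case
    proof
      assume "insert x F \<in> U"
      moreover have "- {x} \<in> U" "- F \<in> U"
        using compl[of "{x}"] compl[of F] insert.IH U by (simp_all add: nonprincipal_ultrafilter_def)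
      ultimately have "insert x F \<inter> (- {x} \<inter> - F) \<in> U"
        by (intro inter)
      moreover have "insert x F \<inter> (- {x} \<inter> - F) = {}"
        by auto
      ultimately show False
        using U by (simp add: nonprincipal_ultrafilter_def)
    qed
  qed
  have "infinite A"
    using fin \<open>A \<in> U\<close> by blast
  then obtain B B' where "B \<subseteq> A" "B' \<subseteq> A" "infinite B" "infinite B'" "B \<inter> B' = {}"
    by (rule infinite_split)
  then have B: "B \<subseteq> A" "infinite B" "infinite (A - B)"
    using finite_subset[of B' "A - B"] by auto
  show False
    using compl[of B]
  proof
    assume "B \<in> U"
    then show False using all[of B] B by (simp add: almost_subset_def)
  next
    assume "- B \<in> U"
    moreover have "A - (- B) = B" using B by auto
    ultimately show False using all[of "- B"] B by (simp add: almost_subset_def)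
  qed
qed

definition pp :: "nat set ext_card" where
  "pp = least_card admits_simple_p_point"

end

theory Submission
  imports Defs
begin

text \<open>
  For \<open>A \<subseteq> \<omega>\<close> let \<open>d\<^sub>A\<close> be the metric under which the points of \<open>A\<close> form a Cauchy sequence while all other
  points stay uniformly isolated. The bounded uniformly continuous functions of \<open>d\<^sub>A\<close> are those that
  converge along \<open>A\<close>, so the Smirnov compactification of \<open>d\<^sub>A\<close> collapses \<open>A\<^sup>* \<subseteq> \<beta>\<omega> - \<omega>\<close> to a point, and
  it grows as \<open>A\<close> shrinks modulo finite sets. If \<open>A\<close> runs through a decreasing sequence generating an
  ultrafilter, the sets \<open>A\<^sup>*\<close> shrink to a single point. Since the length of the sequence has uncountable
  cofinality, every bounded function, having a limit along the ultrafilter, converges along some member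
  of the sequence; hence the supremum of these compactifications is \<open>\<beta>\<omega>\<close>.
\<close>

section \<open>Compactifications and rings of functions\<close>

lemma cptf_embed_in_topspace:
  assumes "is_cptf \<alpha>"
  shows "snd \<alpha> n \<in> topspace (fst \<alpha>)"
proof -
  have emb: "embedding_map (discrete_topology UNIV) (fst \<alpha>) (snd \<alpha>)"
    using assms by (simp add: is_cptf_def)
  show ?thesis
    using homeomorphic_imp_surjective_map[OF emb[unfolded embedding_map_def]] by auto
qed

text \<open>Density of \<omega> together with the Hausdorff property of the target. This makes
  extensions over a compactification unique.\<close>

lemma cptf_functions_eqI:
  assumes "is_cptf \<alpha>" "Hausdorff_space Z"
    and "continuous_map (fst \<alpha>) Z f" "continuous_map (fst \<alpha>) Z g"
    and "\<And>n. f (snd \<alpha> n) = g (snd \<alpha> n)" "x \<in> topspace (fst \<alpha>)"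
  shows "f x = g x"
proof (rule forall_in_closure_of_eq[OF _ assms(2-4)])
  show "x \<in> fst \<alpha> closure_of range (snd \<alpha>)"
    using assms(1,6) by (simp add: is_cptf_def)
qed (use assms(5) in auto)

lemma ext_functions_mono:
  assumes "cptf_le \<alpha> \<gamma>"
  shows "ext_functions \<alpha> \<subseteq> ext_functions \<gamma>"
proof
  obtain h where h: "continuous_map (fst \<gamma>) (fst \<alpha>) h" "\<And>n. h (snd \<gamma> n) = snd \<alpha> n"
    using assms by (auto simp: cptf_le_def)
  fix f assume f: "f \<in> ext_functions \<alpha>"
  then obtain g where "continuous_map (fst \<alpha>) euclideanreal g" "\<And>n. g (snd \<alpha> n) = f n"
    by (auto simp: ext_functions_def)
  then have "continuous_map (fst \<gamma>) euclideanreal (g \<circ> h)" "\<forall>n. (g \<circ> h) (snd \<gamma> n) = f n"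
    using h by (auto intro: continuous_map_compose)
  then show "f \<in> ext_functions \<gamma>"
    using f unfolding ext_functions_def by blast
qed

lemma cptf_equiv_imp_le:
  assumes "cptf_equiv \<alpha> \<gamma>"
  shows "cptf_le \<alpha> \<gamma>"
proof -
  obtain f where f: "homeomorphic_map (fst \<gamma>) (fst \<alpha>) f" "\<forall>n. f (snd \<gamma> n) = snd \<alpha> n"
    using assms by (auto simp: cptf_equiv_def)
  then show ?thesis
    unfolding cptf_le_def
    by (intro exI[of _ f] conjI homeomorphic_imp_continuous_map homeomorphic_imp_surjective_map)
qed

text \<open>Both composites of the two maps fix \<omega> pointwise, so by density they are
  identities and the maps are mutually inverse.\<close>

lemma cptf_le_antisym:
  assumes "is_cptf \<alpha>" "is_cptf \<gamma>" "cptf_le \<alpha> \<gamma>" "cptf_le \<gamma> \<alpha>"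
  shows "cptf_equiv \<alpha> \<gamma>"
proof -
  obtain f where f: "continuous_map (fst \<gamma>) (fst \<alpha>) f" "\<And>n. f (snd \<gamma> n) = snd \<alpha> n"
    using assms(3) by (auto simp: cptf_le_def)
  obtain g where g: "continuous_map (fst \<alpha>) (fst \<gamma>) g" "\<And>n. g (snd \<alpha> n) = snd \<gamma> n"
    using assms(4) by (auto simp: cptf_le_def)
  have "(f \<circ> g) x = id x" if "x \<in> topspace (fst \<alpha>)" for x
    by (rule cptf_functions_eqI[OF assms(1) _ continuous_map_compose[OF g(1) f(1)] continuous_map_id])
       (use assms(1) f g that in \<open>auto simp: is_cptf_def\<close>)
  moreover have "(g \<circ> f) x = id x" if "x \<in> topspace (fst \<gamma>)" for x
    by (rule cptf_functions_eqI[OF assms(2) _ continuous_map_compose[OF f(1) g(1)] continuous_map_id])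
       (use assms(2) f g that in \<open>auto simp: is_cptf_def\<close>)
  ultimately have "homeomorphic_maps (fst \<gamma>) (fst \<alpha>) f g"
    using f(1) g(1) by (simp add: homeomorphic_maps_def)
  then show ?thesis
    unfolding cptf_equiv_def
    by (intro exI[of _ f] conjI allI f(2) homeomorphic_maps_imp_map)
qed

text \<open>
  Evaluation at the functions in \<open>C\<^bsub>\<alpha>\<omega>\<^esub>\<close> embeds \<open>\<alpha>\<omega>\<close> into a power of \<open>\<real>\<close>; by density, \<open>\<gamma>\<omega>\<close> is
  mapped into the image.
\<close>

lemma ext_functions_subset_imp_le:
  assumes "is_cptf \<alpha>" "is_cptf \<gamma>" and sub: "ext_functions \<alpha> \<subseteq> ext_functions \<gamma>"
  shows "cptf_le \<alpha> \<gamma>"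
proof -
  define X e Y e' where "X = fst \<alpha>" and "e = snd \<alpha>" and "Y = fst \<gamma>" and "e' = snd \<gamma>"
  note defs = X_def e_def Y_def e'_def
  have cX: "compact_space X" and hX: "Hausdorff_space X" and cY: "compact_space Y"
    and densX: "X closure_of range e = topspace X" and densY: "Y closure_of range e' = topspace Y"
    using assms(1,2) by (auto simp: is_cptf_def defs)
  have e_in: "range e \<subseteq> topspace X" and e'_in: "range e' \<subseteq> topspace Y"
    using cptf_embed_in_topspace[OF assms(1)] cptf_embed_in_topspace[OF assms(2)]
    by (auto simp: defs)
  define C where "C = ext_functions \<alpha>"
  have "\<exists>g. continuous_map X euclideanreal g \<and> (\<forall>n. g (e n) = f n)" if "f \<in> C" for f
    using that by (auto simp: C_def ext_functions_def defs)
  then obtain E where E: "\<And>f. f \<in> C \<Longrightarrow> continuous_map X euclideanreal (E f)"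
      "\<And>f n. f \<in> C \<Longrightarrow> E f (e n) = f n"
    by metis
  have "\<exists>g. continuous_map Y euclideanreal g \<and> (\<forall>n. g (e' n) = f n)" if "f \<in> C" for f
    using that sub unfolding C_def by (auto simp: ext_functions_def defs)
  then obtain E' where E': "\<And>f. f \<in> C \<Longrightarrow> continuous_map Y euclideanreal (E' f)"
      "\<And>f n. f \<in> C \<Longrightarrow> E' f (e' n) = f n"
    by metis
  \<comment> \<open>The value 0 at indices outside \<open>C\<close> is a mere default; it lets both
    spaces map into the one power indexed by all functions.\<close>
  define h where "h p = (\<lambda>f. if f \<in> C then E f p else 0)" for p
  define k where "k p = (\<lambda>f. if f \<in> C then E' f p else 0)" for p
  let ?P = "product_topology (\<lambda>_. euclideanreal) (UNIV :: (nat \<Rightarrow> real) set)"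
  have hP: "Hausdorff_space ?P"
    by (simp add: Hausdorff_space_product_topology)
  have "continuous_map X euclideanreal (\<lambda>p. h p f)" for f
    using E(1)[of f] by (cases "f \<in> C") (auto simp: h_def eta_contract_eq)
  then have conth: "continuous_map X ?P h"
    by (simp add: continuous_map_componentwise_UNIV)
  have "continuous_map Y euclideanreal (\<lambda>p. k p f)" for f
    using E'(1)[of f] by (cases "f \<in> C") (auto simp: k_def eta_contract_eq)
  then have contk: "continuous_map Y ?P k"
    by (simp add: continuous_map_componentwise_UNIV)
  have hk: "h (e n) = k (e' n)" for n
    by (rule ext) (simp add: h_def k_def E E')
  have inj: "inj_on h (topspace X)"
  proof (rule inj_onI, rule ccontr)
    fix p q
    assume pq: "p \<in> topspace X" "q \<in> topspace X" "h p = h q" "p \<noteq> q"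
    \<comment> \<open>A continuous function separating \<open>p\<close> from \<open>q\<close>
      restricts to a member \<open>f\<close> of \<open>C\<close>, and by uniqueness of extensions
      \<open>E f\<close> is that function, so \<open>h p\<close> and \<open>h q\<close> differ at
      the coordinate \<open>f\<close>.\<close>
    have "completely_regular_space X"
      using cX hX by (simp add: compact_Hausdorff_or_regular_imp_normal_space
          normal_imp_completely_regular_space)
    moreover have "closedin X {q}"
      using hX pq by (simp add: closedin_Hausdorff_singleton)
    ultimately obtain g where g: "continuous_map X (top_of_set {0..1::real}) g" "g p = 0" "g q = 1"
      unfolding completely_regular_space_def using pq by (force dest: spec[of _ "{q}"])
    then have gc: "continuous_map X euclideanreal g" and gb: "g ` topspace X \<subseteq> {0..1}"
      by (auto simp: continuous_map_in_subtopology)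
    define f where "f = (\<lambda>n. g (e n))"
    have "range f \<subseteq> {0..1}"
      using gb e_in by (auto simp: f_def)
    then have "bounded (range f)"
      using bounded_closed_interval bounded_subset by blast
    then have fC: "f \<in> C"
      using gc by (auto simp: C_def ext_functions_def defs f_def)
    have "E f x = g x" if "x \<in> topspace X" for x
    proof (rule cptf_functions_eqI[OF assms(1), of euclideanreal])
      show "E f (snd \<alpha> n) = g (snd \<alpha> n)" for n
        using E(2)[OF fC, of n] by (simp add: f_def e_def)
    qed (use that E(1)[OF fC] gc in \<open>simp_all add: X_def\<close>)
    then have "h p f = 0" "h q f = 1"
      using pq(1,2) g(2,3) fC by (simp_all add: h_def)
    then show False using \<open>h p = h q\<close> by simp
  qed
  have im: "k ` topspace Y \<subseteq> h ` topspace X"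
  proof -
    have "k ` topspace Y \<subseteq> ?P closure_of (k ` range e')"
      using continuous_map_image_closure_subset[OF contk, of "range e'"] densY by simp
    also have "k ` range e' = h ` range e"
      by (simp add: image_image hk)
    also have "?P closure_of (h ` range e) \<subseteq> h ` topspace X"
    proof (rule closure_of_minimal)
      show "closedin ?P (h ` topspace X)"
        by (rule compactin_imp_closedin[OF hP image_compactin[OF cX[unfolded compact_space_def] conth]])
    qed (use e_in in auto)
    finally show ?thesis .
  qed
  define g where "g = inv_into (topspace X) h \<circ> k"
  have "continuous_map (subtopology ?P (h ` topspace X)) X (inv_into (topspace X) h)"
    by (rule continuous_inverse_map[OF cX hP conth]) (use inj in auto)
  moreover have "continuous_map Y (subtopology ?P (h ` topspace X)) k"
    using contk im by (auto simp: continuous_map_in_subtopology)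
  ultimately have contg: "continuous_map Y X g"
    unfolding g_def by (intro continuous_map_compose)
  have ge: "g (e' n) = e n" for n
    using inj e_in by (simp add: g_def hk[symmetric] image_subset_iff)
  \<comment> \<open>The image of \<open>g\<close> is compact, hence closed, and contains the dense
    set \<open>range e\<close>.\<close>
  have "topspace X \<subseteq> g ` topspace Y"
  proof -
    have "X closure_of range e \<subseteq> g ` topspace Y"
    proof (rule closure_of_minimal)
      show "closedin X (g ` topspace Y)"
        by (rule compactin_imp_closedin[OF hX image_compactin[OF cY[unfolded compact_space_def] contg]])
      show "range e \<subseteq> g ` topspace Y"
        using e'_in by (auto simp: ge[symmetric])
    qed
    then show ?thesis using densX by simp
  qed
  then have "g ` topspace Y = topspace X"
    using continuous_map_image_subset_topspace[OF contg] by (rule equalityI[rotated])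
  then show ?thesis
    using contg ge unfolding cptf_le_def by (intro exI[of _ g]) (simp add: defs)
qed

section \<open>Realizing a ring of functions by a compactification\<close>

lemma embedding_discreteI:
  assumes e: "range e \<subseteq> topspace X"
    and sep: "\<And>n. \<exists>V. openin X V \<and> e n \<in> V \<and> (\<forall>m. e m \<in> V \<longrightarrow> m = n)"
  shows "embedding_map (discrete_topology UNIV) X e"
proof -
  have inj: "inj e"
    using sep by (metis injI)
  have "openin (subtopology X (range e)) {e n}" for n
  proof -
    obtain V where "openin X V" "e n \<in> V" "\<forall>m. e m \<in> V \<longrightarrow> m = n"
      using sep[of n] by blast
    then have "{e n} = V \<inter> range e"
      by blast
    then show ?thesis
      using \<open>openin X V\<close> by (auto simp: openin_subtopology)
  qed
  then have "discrete_topology (range e) = subtopology X (range e)"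
    using e by (auto simp: discrete_topology_unique)
  moreover have "homeomorphic_maps (discrete_topology UNIV) (discrete_topology (range e)) e (inv e)"
    using inj by (auto simp: homeomorphic_maps_def)
  ultimately show ?thesis
    by (simp add: embedding_map_def homeomorphic_maps_imp_map)
qed

text \<open>
  The instances for the weaker classes come first because the ones inferred from the metric on
  functions with countable domain would otherwise conflict with that for \<open>t2_space\<close>.
\<close>

instance "fun" :: (type, t0_space) t0_space
proof
  fix f g :: "'a \<Rightarrow> 'b"
  assume "f \<noteq> g"
  then obtain a where "f a \<noteq> g a"
    by (auto simp: fun_eq_iff)
  then obtain U where "open U" "f a \<in> U \<longleftrightarrow> g a \<notin> U"
    using separation_t0[of "f a" "g a"] \<open>f a \<noteq> g a\<close> by blast
  moreover from this have "open ((\<lambda>h :: 'a \<Rightarrow> 'b. h a) -` U)"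
    by (simp add: open_vimage)
  ultimately show "\<exists>U. open U \<and> \<not> (f \<in> U \<longleftrightarrow> g \<in> U)"
    by (intro exI[of _ "(\<lambda>h. h a) -` U"]) auto
qed

instance "fun" :: (type, t1_space) t1_space
proof
  fix f g :: "'a \<Rightarrow> 'b"
  assume "f \<noteq> g"
  then obtain a where "f a \<noteq> g a"
    by (auto simp: fun_eq_iff)
  then obtain U where "open U" "f a \<in> U" "g a \<notin> U"
    using separation_t1[of "f a" "g a"] \<open>f a \<noteq> g a\<close> by blast
  moreover from this have "open ((\<lambda>h :: 'a \<Rightarrow> 'b. h a) -` U)"
    by (simp add: open_vimage)
  ultimately show "\<exists>U. open U \<and> f \<in> U \<and> g \<notin> U"
    by (intro exI[of _ "(\<lambda>h. h a) -` U"]) auto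
qed

text \<open>The Stone-Weierstrass locale \<open>function_ring_on\<close> works over a
  \<open>t2_space\<close>, and the points of the compactification built below are
  functionals.\<close>

instance "fun" :: (type, t2_space) t2_space
proof
  fix f g :: "'a \<Rightarrow> 'b"
  assume "f \<noteq> g"
  then obtain a where "f a \<noteq> g a"
    by (auto simp: fun_eq_iff)
  then obtain U V where "open U" "open V" "f a \<in> U" "g a \<in> V" "U \<inter> V = {}"
    using hausdorff[OF \<open>f a \<noteq> g a\<close>] by blast
  moreover from this have "open ((\<lambda>h :: 'a \<Rightarrow> 'b. h a) -` U)" "open ((\<lambda>h :: 'a \<Rightarrow> 'b. h a) -` V)"
    by (simp_all add: open_vimage)
  ultimately show "\<exists>U V. open U \<and> open V \<and> f \<in> U \<and> g \<in> V \<and> U \<inter> V = {}"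
    by (intro exI[of _ "(\<lambda>h. h a) -` U"] exI[of _ "(\<lambda>h. h a) -` V"]) auto
qed

text \<open>Each number is sent to its evaluation functional on \<open>C\<close>, and the
  compactification is the closure of the image in a power of the reals. Members of \<open>C\<close>
  extend as coordinate projections; conversely, Stone-Weierstrass makes every extendable function a
  uniform limit of members of \<open>C\<close>.\<close>

proposition cptf_of_ring:
  fixes C :: "(nat \<Rightarrow> real) set"
  assumes bdd: "\<And>f. f \<in> C \<Longrightarrow> bounded (range f)"
    and const: "\<And>c. (\<lambda>_. c) \<in> C"
    and add: "\<And>f g. f \<in> C \<Longrightarrow> g \<in> C \<Longrightarrow> (\<lambda>n. f n + g n) \<in> C"
    and mult: "\<And>f g. f \<in> C \<Longrightarrow> g \<in> C \<Longrightarrow> (\<lambda>n. f n * g n) \<in> C"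
    and closed: "\<And>f. (\<And>\<epsilon>. \<epsilon> > 0 \<Longrightarrow> \<exists>g\<in>C. \<forall>n. \<bar>f n - g n\<bar> < \<epsilon>) \<Longrightarrow> f \<in> C"
    and points: "\<And>n. indicator {n} \<in> C"
  shows "\<exists>\<alpha> :: point cptf. is_cptf \<alpha> \<and> ext_functions \<alpha> = C"
proof -
  define e :: "nat \<Rightarrow> point" where "e n = (\<lambda>f. if f \<in> C then f n else 0)" for n
  define K where "K = closure (range e)"
  have "\<exists>B. \<forall>n. \<bar>f n\<bar> \<le> B" if "f \<in> C" for f
    using bdd[OF that] by (auto simp: bounded_iff)
  then obtain B where B: "\<And>f n. f \<in> C \<Longrightarrow> \<bar>f n\<bar> \<le> B f"
    by metis
  \<comment> \<open>A Tychonoff cube containing all evaluations; the factor \<open>{0}\<close>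
    matches the default value in \<open>e\<close>.\<close>
  define Q where "Q = (\<Pi>\<^sub>E f\<in>UNIV. if f \<in> C then {- B f .. B f} else {0})"
  have "compact Q"
  proof -
    have "compactin (product_topology (\<lambda>_. euclideanreal) (UNIV :: (nat \<Rightarrow> real) set)) Q"
      unfolding Q_def compactin_PiE by auto
    then show ?thesis
      by (simp add: euclidean_product_topology)
  qed
  moreover have "range e \<subseteq> Q"
    using B by (force simp: Q_def e_def abs_le_iff)
  ultimately have "K \<subseteq> Q"
    unfolding K_def by (simp add: closure_minimal compact_imp_closed)
  then have "compact K"
    using \<open>compact Q\<close> compact_Int_closed[of Q K] by (simp add: K_def inf_absorb2)
  have eK: "e n \<in> K" for n
    using closure_subset[of "range e"] by (auto simp: K_def)
  have contev: "continuous_on K (\<lambda>p. p f)" for f :: "nat \<Rightarrow> real"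
    by (rule continuous_on_subset[OF continuous_on_product_coordinates subset_UNIV])
  have "Hausdorff_space (product_topology (\<lambda>_. euclideanreal) (UNIV :: (nat \<Rightarrow> real) set))"
    by (simp add: Hausdorff_space_product_topology)
  then have hausdorff_euclidean: "Hausdorff_space (euclidean :: point topology)"
    by (simp add: euclidean_product_topology)
  let ?\<alpha> = "(top_of_set K, e)"
  have "embedding_map (discrete_topology UNIV) (top_of_set K) e"
  proof (rule embedding_discreteI)
    fix n
    \<comment> \<open>The coordinate at the indicator of \<open>{n}\<close> is 1 at
      \<open>e n\<close> and 0 at every other \<open>e m\<close>, so the threshold 1/2 isolates
      \<open>e n\<close>.\<close>
    let ?V = "K \<inter> {p. p (indicator {n}) > 1/2}"
    have "open {p :: point. p (indicator {n}) > 1/2}"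
      by (intro open_Collect_less continuous_on_const continuous_on_product_coordinates)
    then have "openin (top_of_set K) ?V"
      by (simp add: openin_open_Int)
    then show "\<exists>V. openin (top_of_set K) V \<and> e n \<in> V \<and> (\<forall>m. e m \<in> V \<longrightarrow> m = n)"
      using eK points by (intro exI[of _ ?V]) (auto simp: e_def indicator_def split: if_splits)
  qed (use eK in auto)
  moreover have "top_of_set K closure_of range e = K"
    using eK by (simp add: closure_of_subtopology K_def Int_absorb1 image_subset_iff)
  ultimately have "is_cptf ?\<alpha>"
    using \<open>compact K\<close>
    by (simp add: is_cptf_def hausdorff_euclidean Hausdorff_space_subtopology compact_space_subtopology)
  moreover have "ext_functions ?\<alpha> = C"
  proof
    show "C \<subseteq> ext_functions ?\<alpha>"
    proof
      fix f assume f: "f \<in> C"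
      then have "\<And>n. e n f = f n"
        by (simp add: e_def)
      then show "f \<in> ext_functions ?\<alpha>"
        using contev[of f] bdd[OF f] by (auto simp: ext_functions_def)
    qed
    \<comment> \<open>The continuous functions on \<open>K\<close> whose restriction to \<omega>
      lies in \<open>C\<close>. They inherit the ring operations from \<open>C\<close> and separate
      points because they include all coordinates; a coordinate outside \<open>C\<close> restricts
      to the constant 0.\<close>
    define R where "R = {g. continuous_on K g \<and> (\<lambda>n. g (e n)) \<in> C}"
    have evR: "(\<lambda>p. p f) \<in> R" for f
      using contev[of f] const[of 0] by (cases "f \<in> C") (auto simp: R_def e_def)
    interpret function_ring_on R K
    proof
      fix p q :: point assume "p \<noteq> q"
      then obtain f where "p f \<noteq> q f"
        by (auto simp: fun_eq_iff)
      then show "\<exists>g\<in>R. g p \<noteq> g q"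
        using evR by (intro bexI[of _ "\<lambda>p. p f"])
    qed (use \<open>compact K\<close> const add mult in \<open>auto simp: R_def intro!: continuous_intros\<close>)
    show "ext_functions ?\<alpha> \<subseteq> C"
    proof
      fix f assume "f \<in> ext_functions ?\<alpha>"
      then obtain g where g: "continuous_on K g" "\<And>n. g (e n) = f n"
        by (auto simp: ext_functions_def)
      show "f \<in> C"
      proof (rule closed)
        fix \<epsilon> :: real assume "\<epsilon> > 0"
        then obtain h where "h \<in> R" "\<forall>x\<in>K. \<bar>g x - h x\<bar> < \<epsilon>"
          using Stone_Weierstrass_basic[OF g(1)] by blast
        then show "\<exists>h\<in>C. \<forall>n. \<bar>f n - h n\<bar> < \<epsilon>"
          using eK by (intro bexI[of _ "\<lambda>n. h (e n)"]) (auto simp: R_def g(2)[symmetric])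
      qed
    qed
  qed
  ultimately show ?thesis
    by blast
qed

section \<open>The ring of all bounded functions and the Stone-Cech compactification\<close>

definition bounded_functions :: "(nat \<Rightarrow> real) set" where
  "bounded_functions = {f. bounded (range f)}"

lemma bounded_functions_iff: "f \<in> bounded_functions \<longleftrightarrow> (\<exists>B>0. \<forall>n. \<bar>f n\<bar> \<le> B)"
  by (auto simp: bounded_functions_def bounded_pos)

lemma bounded_functions_add:
  assumes "f \<in> bounded_functions" "g \<in> bounded_functions"
  shows "(\<lambda>n. f n + g n) \<in> bounded_functions"
  using assms unfolding bounded_functions_def by (auto intro: bounded_plus_comp)

lemma bounded_functions_mult:
  assumes "f \<in> bounded_functions" "g \<in> bounded_functions"
  shows "(\<lambda>n. f n * g n) \<in> bounded_functions"
proof -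
  obtain A B where "A > 0" "\<And>n. \<bar>f n\<bar> \<le> A" "B > 0" "\<And>n. \<bar>g n\<bar> \<le> B"
    using assms by (auto simp: bounded_functions_iff)
  then have "A * B > 0" "\<bar>f n * g n\<bar> \<le> A * B" for n
    by (simp_all add: abs_mult mult_mono)
  then show ?thesis
    unfolding bounded_functions_iff by blast
qed

lemma bounded_functions_closed:
  assumes "\<And>\<epsilon>. \<epsilon> > 0 \<Longrightarrow> \<exists>g\<in>bounded_functions. \<forall>n. \<bar>f n - g n\<bar> < \<epsilon>"
  shows "f \<in> bounded_functions"
proof -
  obtain g where g: "g \<in> bounded_functions" "\<And>n. \<bar>f n - g n\<bar> < 1"
    using assms[of 1] by auto
  then obtain B where "B > 0" "\<And>n. \<bar>g n\<bar> \<le> B"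
    by (auto simp: bounded_functions_iff)
  have "\<bar>f n\<bar> \<le> B + 1" for n
    using g(2)[of n] \<open>\<And>n. \<bar>g n\<bar> \<le> B\<close>[of n] by linarith
  then show ?thesis
    unfolding bounded_functions_iff using \<open>B > 0\<close> by (intro exI[of _ "B + 1"]) auto
qed

lemma bounded_functions_const: "(\<lambda>_. c) \<in> bounded_functions"
  by (simp add: bounded_functions_def)

lemma bounded_functions_indicator: "indicator A \<in> bounded_functions"
  by (auto simp: bounded_functions_iff indicator_def intro!: exI[of _ 1])

text \<open>A compactification over which all bounded functions extend lies above every other, so
  the choice defining \<open>stone_cech\<close> has a witness.\<close>

lemma stone_cech_works:
  shows is_cptf_stone_cech: "is_cptf stone_cech"
    and stone_cech_greatest: "\<And>\<alpha> :: point cptf. is_cptf \<alpha> \<Longrightarrow> cptf_le \<alpha> stone_cech"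
    and ext_functions_stone_cech: "ext_functions stone_cech = bounded_functions"
proof -
  have "\<exists>\<beta> :: point cptf. is_cptf \<beta> \<and> ext_functions \<beta> = bounded_functions"
    by (rule cptf_of_ring)
       (simp_all add: bounded_functions_add bounded_functions_mult bounded_functions_const
          bounded_functions_indicator bounded_functions_closed, simp add: bounded_functions_def)
  then obtain \<beta> :: "point cptf" where \<beta>: "is_cptf \<beta>" "ext_functions \<beta> = bounded_functions"
    by blast
  have sub: "ext_functions \<alpha> \<subseteq> bounded_functions" for \<alpha> :: "point cptf"
    by (auto simp: ext_functions_def bounded_functions_def)
  have "cptf_le \<alpha> \<beta>" if "is_cptf \<alpha>" for \<alpha> :: "point cptf"
    using ext_functions_subset_imp_le[OF that \<beta>(1)] \<beta>(2) sub by simp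
  then have "is_cptf \<beta> \<and> (\<forall>\<alpha> :: point cptf. is_cptf \<alpha> \<longrightarrow> cptf_le \<alpha> \<beta>)"
    using \<beta>(1) by blast
  then have "is_cptf stone_cech \<and> (\<forall>\<alpha> :: point cptf. is_cptf \<alpha> \<longrightarrow> cptf_le \<alpha> stone_cech)"
    unfolding stone_cech_def by (rule someI)
  then show "is_cptf stone_cech" and greatest: "\<And>\<alpha> :: point cptf. is_cptf \<alpha> \<Longrightarrow> cptf_le \<alpha> stone_cech"
    by blast+
  \<comment> \<open>The chosen compactification need not be \<open>\<beta>\<close> itself, but it
    lies above \<open>\<beta>\<close> and so has at least as many extendable functions.\<close>
  have "bounded_functions \<subseteq> ext_functions stone_cech"
    using ext_functions_mono[OF greatest[OF \<beta>(1)]] \<beta>(2) by simp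
  then show "ext_functions stone_cech = bounded_functions"
    using sub by (rule equalityI[rotated])
qed

section \<open>Smirnov compactifications\<close>

lemma bdd_unif_cont_iff:
  assumes "Metric_space UNIV d"
  shows "f \<in> bdd_unif_cont d \<longleftrightarrow>
    f \<in> bounded_functions \<and> (\<forall>\<epsilon>>0. \<exists>\<delta>>0. \<forall>x y. d x y < \<delta> \<longrightarrow> \<bar>f x - f y\<bar> < \<epsilon>)"
proof -
  interpret Metric_space UNIV d by (rule assms)
  have swap: "(\<forall>x y. d y x < \<delta> \<longrightarrow> dist (f y) (f x) < \<epsilon>) \<longleftrightarrow> (\<forall>x y. d x y < \<delta> \<longrightarrow> \<bar>f x - f y\<bar> < \<epsilon>)" for \<delta> \<epsilon>
    by (auto simp: dist_real_def)
  show ?thesis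
    by (simp add: bdd_unif_cont_def bounded_functions_def uniformly_continuous_map_def swap)
qed

lemma bdd_unif_contE:
  assumes "Metric_space UNIV d" "f \<in> bdd_unif_cont d" "\<epsilon> > 0"
  obtains \<delta> where "\<delta> > 0" "\<forall>x y. d x y < \<delta> \<longrightarrow> \<bar>f x - f y\<bar> < \<epsilon>"
  using assms by (auto simp: bdd_unif_cont_iff)

lemma bdd_unif_cont_mult:
  assumes d: "Metric_space UNIV d" and f: "f \<in> bdd_unif_cont d" and g: "g \<in> bdd_unif_cont d"
  shows "(\<lambda>n. f n * g n) \<in> bdd_unif_cont d"
  unfolding bdd_unif_cont_iff[OF d]
proof (intro conjI allI impI)
  have bf: "f \<in> bounded_functions" and bg: "g \<in> bounded_functions"
    using f g by (auto simp: bdd_unif_cont_iff[OF d])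
  then show "(\<lambda>n. f n * g n) \<in> bounded_functions"
    by (rule bounded_functions_mult)
  obtain A B where A: "A > 0" "\<And>n. \<bar>f n\<bar> \<le> A" and B: "B > 0" "\<And>n. \<bar>g n\<bar> \<le> B"
    using bf bg by (auto simp: bounded_functions_iff)
  fix \<epsilon> :: real assume "\<epsilon> > 0"
  then have "\<epsilon> / (2 * A) > 0" "\<epsilon> / (2 * B) > 0"
    using A(1) B(1) by simp_all
  obtain \<delta> where \<delta>: "\<delta> > 0" "\<forall>x y. d x y < \<delta> \<longrightarrow> \<bar>f x - f y\<bar> < \<epsilon> / (2 * B)"
    by (rule bdd_unif_contE[OF d f \<open>\<epsilon> / (2 * B) > 0\<close>])
  obtain \<delta>' where \<delta>': "\<delta>' > 0" "\<forall>x y. d x y < \<delta>' \<longrightarrow> \<bar>g x - g y\<bar> < \<epsilon> / (2 * A)"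
    by (rule bdd_unif_contE[OF d g \<open>\<epsilon> / (2 * A) > 0\<close>])
  have "\<bar>f x * g x - f y * g y\<bar> < \<epsilon>" if "d x y < min \<delta> \<delta>'" for x y
  proof -
    have "\<bar>f x * g x - f y * g y\<bar> = \<bar>f x * (g x - g y) + (f x - f y) * g y\<bar>"
      by (simp add: algebra_simps)
    also have "\<dots> \<le> \<bar>f x\<bar> * \<bar>g x - g y\<bar> + \<bar>f x - f y\<bar> * \<bar>g y\<bar>"
      by (metis abs_mult abs_triangle_ineq)
    also have "\<dots> \<le> A * \<bar>g x - g y\<bar> + \<bar>f x - f y\<bar> * B"
      by (intro add_mono mult_mono) (use A B in auto)
    also have "\<dots> < A * (\<epsilon> / (2 * A)) + \<epsilon> / (2 * B) * B"
      using \<delta>(2)[rule_format, of x y] \<delta>'(2)[rule_format, of x y] that A(1) B(1)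
      by (intro add_strict_mono mult_strict_left_mono mult_strict_right_mono) auto
    also have "\<dots> = \<epsilon>"
      using A(1) B(1) by simp
    finally show ?thesis .
  qed
  then show "\<exists>\<delta>>0. \<forall>x y. d x y < \<delta> \<longrightarrow> \<bar>f x * g x - f y * g y\<bar> < \<epsilon>"
    using \<delta>(1) \<delta>'(1) by (intro exI[of _ "min \<delta> \<delta>'"]) auto
qed

lemma bdd_unif_cont_add:
  assumes d: "Metric_space UNIV d" and f: "f \<in> bdd_unif_cont d" and g: "g \<in> bdd_unif_cont d"
  shows "(\<lambda>n. f n + g n) \<in> bdd_unif_cont d"
  unfolding bdd_unif_cont_iff[OF d]
proof (intro conjI allI impI)
  show "(\<lambda>n. f n + g n) \<in> bounded_functions"
    using f g by (simp add: bdd_unif_cont_iff[OF d] bounded_functions_add)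
  fix \<epsilon> :: real assume "\<epsilon> > 0"
  then have "\<epsilon> / 2 > 0"
    by simp
  obtain \<delta> where \<delta>: "\<delta> > 0" "\<forall>x y. d x y < \<delta> \<longrightarrow> \<bar>f x - f y\<bar> < \<epsilon> / 2"
    by (rule bdd_unif_contE[OF d f \<open>\<epsilon> / 2 > 0\<close>])
  obtain \<delta>' where \<delta>': "\<delta>' > 0" "\<forall>x y. d x y < \<delta>' \<longrightarrow> \<bar>g x - g y\<bar> < \<epsilon> / 2"
    by (rule bdd_unif_contE[OF d g \<open>\<epsilon> / 2 > 0\<close>])
  have "\<bar>f x + g x - (f y + g y)\<bar> < \<epsilon>" if "d x y < min \<delta> \<delta>'" for x y
    using \<delta>(2)[rule_format, of x y] \<delta>'(2)[rule_format, of x y] that unfolding min_less_iff_conj by linarith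
  then show "\<exists>\<delta>>0. \<forall>x y. d x y < \<delta> \<longrightarrow> \<bar>f x + g x - (f y + g y)\<bar> < \<epsilon>"
    using \<delta>(1) \<delta>'(1) by (intro exI[of _ "min \<delta> \<delta>'"]) auto
qed

lemma bdd_unif_cont_closed:
  assumes d: "Metric_space UNIV d"
    and *: "\<And>\<epsilon>. \<epsilon> > 0 \<Longrightarrow> \<exists>g\<in>bdd_unif_cont d. \<forall>n. \<bar>f n - g n\<bar> < \<epsilon>"
  shows "f \<in> bdd_unif_cont d"
  unfolding bdd_unif_cont_iff[OF d]
proof (intro conjI allI impI)
  show "f \<in> bounded_functions"
  proof (rule bounded_functions_closed)
    show "\<exists>g\<in>bounded_functions. \<forall>n. \<bar>f n - g n\<bar> < \<epsilon>" if "\<epsilon> > 0" for \<epsilon>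
      using *[OF that] bdd_unif_cont_iff[OF d] by blast
  qed
  fix \<epsilon> :: real assume "\<epsilon> > 0"
  then obtain g where g: "g \<in> bdd_unif_cont d" "\<And>n. \<bar>f n - g n\<bar> < \<epsilon> / 3"
    using *[of "\<epsilon> / 3"] by auto
  have "\<epsilon> / 3 > 0"
    using \<open>\<epsilon> > 0\<close> by simp
  obtain \<delta> where \<delta>: "\<delta> > 0" "\<forall>x y. d x y < \<delta> \<longrightarrow> \<bar>g x - g y\<bar> < \<epsilon> / 3"
    by (rule bdd_unif_contE[OF d g(1) \<open>\<epsilon> / 3 > 0\<close>])
  have "\<bar>f x - f y\<bar> < \<epsilon>" if "d x y < \<delta>" for x y
    using \<delta>(2)[rule_format, OF that] g(2)[of x] g(2)[of y] by linarith
  then show "\<exists>\<delta>>0. \<forall>x y. d x y < \<delta> \<longrightarrow> \<bar>f x - f y\<bar> < \<epsilon>"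
    using \<delta>(1) by blast
qed

text \<open>By discreteness some ball around \<open>n\<close> is just \<open>{n}\<close>; two points
  closer than its radius are both \<open>n\<close> or both different from \<open>n\<close>.\<close>

lemma indicator_bdd_unif_cont:
  assumes "d \<in> metrics"
  shows "indicator {n} \<in> bdd_unif_cont d"
proof -
  have d: "Metric_space UNIV d" and top: "Metric_space.mtopology UNIV d = discrete_topology UNIV"
    using assms by (auto simp: metrics_def)
  interpret Metric_space UNIV d by (rule d)
  obtain r where r: "r > 0" "mball n r \<subseteq> {n}"
    using top openin_mtopology[of "{n}"] by auto
  have near: "y = n" if "d n y < r" for y
    using r(2) that by auto
  have "x = n \<longleftrightarrow> y = n" if "d x y < r" for x y
    using near[of x] near[of y] that commute[of x y] by metis
  then have "\<bar>indicator {n} x - indicator {n} y\<bar> < \<epsilon>" if "d x y < r" "\<epsilon> > 0" for x y and \<epsilon> :: real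
    using that by (simp add: indicator_def)
  then show ?thesis
    using r(1) by (auto simp: bdd_unif_cont_iff[OF d] bounded_functions_indicator)
qed

text \<open>The bounded uniformly continuous functions satisfy the conditions of
  \<open>cptf_of_ring\<close>, which gives the choice in \<open>smirnov\<close> a witness.\<close>

lemma smirnov_works:
  assumes "d \<in> metrics"
  shows "is_cptf (smirnov d)" "ext_functions (smirnov d) = bdd_unif_cont d"
proof -
  have d: "Metric_space UNIV d"
    using assms by (simp add: metrics_def)
  have "\<exists>\<alpha> :: point cptf. is_cptf \<alpha> \<and> ext_functions \<alpha> = bdd_unif_cont d"
  proof (rule cptf_of_ring)
    show "(\<lambda>_. c) \<in> bdd_unif_cont d" for c
      by (auto simp: bdd_unif_cont_iff[OF d] bounded_functions_const intro: exI[of _ 1])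
    show "bounded (range f)" if "f \<in> bdd_unif_cont d" for f
      using that by (simp add: bdd_unif_cont_def)
  qed (rule bdd_unif_cont_add[OF d] bdd_unif_cont_mult[OF d] bdd_unif_cont_closed[OF d]
      indicator_bdd_unif_cont[OF assms]; assumption)+
  then have "is_cptf (smirnov d) \<and> ext_functions (smirnov d) = bdd_unif_cont d"
    unfolding smirnov_def by (rule someI_ex)
  then show "is_cptf (smirnov d)" "ext_functions (smirnov d) = bdd_unif_cont d"
    by blast+
qed

text \<open>Compactifications with the same extendable functions are equivalent. Membership in
  \<open>metrics'\<close> thereby becomes a question about functions alone.\<close>

lemma metrics'_iff: "d \<in> metrics' \<longleftrightarrow> d \<in> metrics \<and> \<not> bounded_functions \<subseteq> bdd_unif_cont d"
proof -
  have "cptf_equiv stone_cech (smirnov d) \<longleftrightarrow> bounded_functions \<subseteq> bdd_unif_cont d"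
    if "d \<in> metrics"
  proof
    assume "cptf_equiv stone_cech (smirnov d)"
    then show "bounded_functions \<subseteq> bdd_unif_cont d"
      using ext_functions_mono[OF cptf_equiv_imp_le] smirnov_works(2)[OF that]
        ext_functions_stone_cech by metis
  next
    assume "bounded_functions \<subseteq> bdd_unif_cont d"
    then have "bdd_unif_cont d = bounded_functions"
      by (auto simp: bdd_unif_cont_def bounded_functions_def)
    then show "cptf_equiv stone_cech (smirnov d)"
      using smirnov_works[OF that] is_cptf_stone_cech stone_cech_greatest
      by (intro cptf_le_antisym ext_functions_subset_imp_le)
         (simp_all add: ext_functions_stone_cech)
  qed
  then show ?thesis
    by (auto simp: metrics'_def)
qed

text \<open>The ring of an upper bound contains every \<open>bdd_unif_cont d\<close>, hence by the
  covering assumption all bounded functions. So every upper bound lies above \<beta>\<omega>, which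
  is therefore the supremum.\<close>

lemma stone_cech_equiv_sup_smirnov:
  assumes D: "D \<subseteq> metrics" and cover: "bounded_functions \<subseteq> (\<Union>d\<in>D. bdd_unif_cont d)"
  shows "cptf_equiv stone_cech (cptf_sup (smirnov ` D))"
proof -
  let ?A = "smirnov ` D"
  have least: "cptf_le stone_cech \<gamma>" if \<gamma>: "is_cptf \<gamma>" "\<forall>\<alpha>\<in>?A. cptf_le \<alpha> \<gamma>" for \<gamma> :: "point cptf"
  proof (rule ext_functions_subset_imp_le[OF is_cptf_stone_cech \<gamma>(1)])
    have "bdd_unif_cont d \<subseteq> ext_functions \<gamma>" if "d \<in> D" for d
      using ext_functions_mono[of "smirnov d" \<gamma>] smirnov_works(2)[of d] \<gamma>(2) D that by auto
    then show "ext_functions stone_cech \<subseteq> ext_functions \<gamma>"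
      using cover unfolding ext_functions_stone_cech by blast
  qed
  have "\<forall>\<alpha>\<in>?A. cptf_le \<alpha> stone_cech"
    using D smirnov_works(1) stone_cech_greatest by blast
  then have "is_cptf_sup ?A stone_cech"
    unfolding is_cptf_sup_def using is_cptf_stone_cech least by blast
  then have "is_cptf_sup ?A (cptf_sup ?A)"
    unfolding cptf_sup_def by (rule someI)
  then have sup: "is_cptf (cptf_sup ?A)" "\<forall>\<alpha>\<in>?A. cptf_le \<alpha> (cptf_sup ?A)"
    unfolding is_cptf_sup_def by blast+
  show ?thesis
    by (rule cptf_le_antisym[OF is_cptf_stone_cech sup(1) least[OF sup] stone_cech_greatest[OF sup(1)]])
qed

section \<open>Metrics that collapse a set at infinity\<close>

definition weight :: "nat set \<Rightarrow> nat \<Rightarrow> real" where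
  "weight A n = (if n \<in> A then 1 / real (Suc n) else 1)"

text \<open>A hedgehog metric: \<open>n\<close> is the tip of a spine of length
  \<open>weight A n\<close>, and distinct tips are joined through the common centre. Only spines
  over \<open>A\<close> become short.\<close>

definition collapse :: "nat set \<Rightarrow> nat \<Rightarrow> nat \<Rightarrow> real" where
  "collapse A m n = (if m = n then 0 else weight A m + weight A n)"

lemma weight_pos: "weight A n > 0"
  by (simp add: weight_def)

lemma Metric_space_collapse: "Metric_space UNIV (collapse A)"
proof
  show "collapse A x z \<le> collapse A x y + collapse A y z" for x y z
    using weight_pos[of A x] weight_pos[of A y] weight_pos[of A z] by (simp add: collapse_def)
  show "collapse A x y = 0 \<longleftrightarrow> x = y" for x y
    using weight_pos[of A x] weight_pos[of A y] by (simp add: collapse_def)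
  show "0 \<le> collapse A x y" for x y
    using weight_pos[of A x] weight_pos[of A y] by (simp add: collapse_def)
qed (simp add: collapse_def)

lemma collapse_in_metrics: "collapse A \<in> metrics"
proof -
  interpret Metric_space UNIV "collapse A" by (rule Metric_space_collapse)
  have "openin mtopology {x}" for x
  proof -
    have "y = x" if "collapse A x y < weight A x" for y
      using that weight_pos[of A y] by (simp add: collapse_def split: if_splits)
    then have "mball x (weight A x) \<subseteq> {x}"
      by auto
    then show ?thesis
      unfolding openin_mtopology using weight_pos[of A x] by auto
  qed
  then have "discrete_topology UNIV = mtopology"
    by (simp add: discrete_topology_unique)
  then show ?thesis
    by (simp add: metrics_def Metric_space_collapse)
qed

text \<open>Distinct points are close exactly when both are large elements of \<open>A\<close>.
  Uniform continuity is thus the Cauchy condition along \<open>A\<close>, stated by oscillation so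
  that no limit has to be named.\<close>

lemma bdd_unif_cont_collapse_iff:
  "f \<in> bdd_unif_cont (collapse A) \<longleftrightarrow>
    f \<in> bounded_functions \<and>
    (\<forall>\<epsilon>>0. \<exists>F. finite F \<and> (\<forall>x\<in>A - F. \<forall>y\<in>A - F. \<bar>f x - f y\<bar> < \<epsilon>))"
proof -
  have "(\<exists>\<delta>>0. \<forall>x y. collapse A x y < \<delta> \<longrightarrow> \<bar>f x - f y\<bar> < \<epsilon>) \<longleftrightarrow>
      (\<exists>F. finite F \<and> (\<forall>x\<in>A - F. \<forall>y\<in>A - F. \<bar>f x - f y\<bar> < \<epsilon>))" (is "?L \<longleftrightarrow> ?R")
    if "\<epsilon> > 0" for \<epsilon> :: real
  proof
    assume ?L
    then obtain \<delta> where \<delta>: "\<delta> > 0" "\<forall>x y. collapse A x y < \<delta> \<longrightarrow> \<bar>f x - f y\<bar> < \<epsilon>"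
      by blast
    \<comment> \<open>Half of \<open>\<delta>\<close> because a distance is the sum of two
      weights.\<close>
    obtain N where N: "1 / real (Suc N) < \<delta> / 2"
      using \<delta>(1) nat_approx_posE[of "\<delta> / 2"] by auto
    have small: "weight A x < \<delta> / 2" if "x \<in> A - {..N}" for x
    proof -
      have "1 / real (Suc x) \<le> 1 / real (Suc N)"
        using that by (intro divide_left_mono) auto
      then show ?thesis
        using N that by (simp add: weight_def)
    qed
    have "collapse A x y < \<delta>" if "x \<in> A - {..N}" "y \<in> A - {..N}" for x y
      using small[of x] small[of y] that \<delta>(1)
      by (simp add: collapse_def)
    then show ?R
      using \<delta>(2) by (intro exI[of _ "{..N}"]) simp
  next
    assume ?R
    then obtain F where F: "finite F" "\<forall>x\<in>A - F. \<forall>y\<in>A - F. \<bar>f x - f y\<bar> < \<epsilon>"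
      by blast
    obtain N where N: "F \<subseteq> {..<N}"
      using F(1) finite_nat_iff_bounded by blast
    \<comment> \<open>A weight below this bound is below 1, which forces membership in
      \<open>A\<close>, and it belongs to an index above \<open>N\<close>, hence outside
      \<open>F\<close>.\<close>
    let ?\<delta> = "1 / real (Suc N)"
    have mem: "x \<in> A - F" if "weight A x < ?\<delta>" for x
    proof -
      have "?\<delta> \<le> 1"
        by simp
      then have "x \<in> A" "1 / real (Suc x) < ?\<delta>"
        using that by (auto simp: weight_def split: if_splits)
      moreover from this have "N < x"
        by (simp add: divide_simps)
      ultimately show ?thesis
        using N by auto
    qed
    have "\<bar>f x - f y\<bar> < \<epsilon>" if less: "collapse A x y < ?\<delta>" for x y
    proof (cases "x = y")
      case False
      then have "weight A x < ?\<delta>" "weight A y < ?\<delta>"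
        using less weight_pos[of A x] weight_pos[of A y] by (simp_all add: collapse_def)
      then show ?thesis
        using F(2) mem by simp
    qed (use \<open>\<epsilon> > 0\<close> in simp)
    then show ?L
      by (intro exI[of _ ?\<delta>]) simp
  qed
  then show ?thesis
    by (simp add: bdd_unif_cont_iff[OF Metric_space_collapse])
qed

text \<open>
  If the set below is infinite, the indicator function of one half of it is constant on the rest of
  \<open>\<omega>\<close> but does not converge along the set.
\<close>

lemma split_indicator_not_bdd_unif_cont:
  assumes "infinite X"
  obtains H where "H \<subseteq> X" "\<forall>A. X \<subseteq> A \<longrightarrow> indicator H \<notin> bdd_unif_cont (collapse A)"
proof -
  obtain H H' where H: "H \<subseteq> X" "H' \<subseteq> X" "infinite H" "infinite H'" "H \<inter> H' = {}"
    using assms by (rule infinite_split)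
  have "indicator H \<notin> bdd_unif_cont (collapse A)" if "X \<subseteq> A" for A
  proof
    assume "indicator H \<in> bdd_unif_cont (collapse A)"
    then have "\<exists>F. finite F \<and> (\<forall>x\<in>A - F. \<forall>y\<in>A - F. \<bar>indicator H x - indicator H y\<bar> < (1::real))"
      unfolding bdd_unif_cont_collapse_iff by simp
    then obtain F where F: "finite F"
      "\<forall>x\<in>A - F. \<forall>y\<in>A - F. \<bar>indicator H x - indicator H y\<bar> < (1::real)"
      by blast
    have "H - F \<noteq> {}" "H' - F \<noteq> {}"
      by (rule infinite_imp_nonempty[OF Diff_infinite_finite[OF F(1) H(3)]],
          rule infinite_imp_nonempty[OF Diff_infinite_finite[OF F(1) H(4)]])
    then obtain x y where "x \<in> H - F" "y \<in> H' - F"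
      by blast
    then have "x \<in> A - F" "y \<in> A - F" and H_mem: "x \<in> H" "y \<notin> H"
      using H(1,2,5) that by auto
    then show False
      using F(2)[rule_format, of x y] by simp
  qed
  then show thesis
    using that H(1) by blast
qed

text \<open>If \<open>B - A\<close> is infinite, the indicator of one half of it vanishes on
  \<open>A\<close> but oscillates along \<open>B\<close>. If \<open>B - A\<close> is finite, adding
  it to the exceptional sets for \<open>A\<close> gives exceptional sets for
  \<open>B\<close>.\<close>

lemma metric_le_collapse_iff:
  "metric_le (collapse A) (collapse B) \<longleftrightarrow> almost_subset B A"
proof
  assume le: "metric_le (collapse A) (collapse B)"
  show "almost_subset B A"
  proof (rule ccontr)
    assume "\<not> almost_subset B A"
    then have "infinite (B - A)"
      by (simp add: almost_subset_def)
    then obtain H where H: "H \<subseteq> B - A"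
      and not: "\<forall>X. B - A \<subseteq> X \<longrightarrow> indicator H \<notin> bdd_unif_cont (collapse X)"
      by (rule split_indicator_not_bdd_unif_cont)
    have "\<bar>indicator H x - indicator H y\<bar> < \<epsilon>" if "x \<in> A" "y \<in> A" "\<epsilon> > 0" for x y and \<epsilon> :: real
    proof -
      have "x \<notin> H" "y \<notin> H"
        using H that by auto
      then show ?thesis
        using that by simp
    qed
    then have "indicator H \<in> bdd_unif_cont (collapse A)"
      unfolding bdd_unif_cont_collapse_iff
      by (intro conjI allI impI exI[of _ "{}"]) (simp_all add: bounded_functions_indicator)
    then show False
      using le not by (auto simp: metric_le_def)
  qed
next
  assume sub: "almost_subset B A"
  show "metric_le (collapse A) (collapse B)"
    unfolding metric_le_def
  proof
    fix f assume f: "f \<in> bdd_unif_cont (collapse A)"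
    have "\<exists>F. finite F \<and> (\<forall>x\<in>B - F. \<forall>y\<in>B - F. \<bar>f x - f y\<bar> < \<epsilon>)" if "\<epsilon> > 0" for \<epsilon>
    proof -
      obtain F where "finite F" "\<forall>x\<in>A - F. \<forall>y\<in>A - F. \<bar>f x - f y\<bar> < \<epsilon>"
        using f \<open>\<epsilon> > 0\<close> unfolding bdd_unif_cont_collapse_iff by blast
      then show ?thesis
        using sub by (intro exI[of _ "F \<union> (B - A)"]) (auto simp: almost_subset_def)
    qed
    then show "f \<in> bdd_unif_cont (collapse B)"
      using f by (simp add: bdd_unif_cont_collapse_iff)
  qed
qed

lemma collapse_in_metrics':
  assumes "infinite A"
  shows "collapse A \<in> metrics'"
proof -
  obtain H where "H \<subseteq> A" "\<forall>X. A \<subseteq> X \<longrightarrow> indicator H \<notin> bdd_unif_cont (collapse X)"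
    using assms by (rule split_indicator_not_bdd_unif_cont)
  then have "indicator H \<notin> bdd_unif_cont (collapse A)"
    by simp
  then show ?thesis
    using bounded_functions_indicator[of H] by (auto simp: metrics'_iff collapse_in_metrics)
qed

section \<open>Simple p-points\<close>

lemma ultrafilter_finite:
  assumes U: "nonprincipal_ultrafilter U" and "finite F"
  shows "F \<notin> U"
  using assms(2)
proof (induction F)
  case empty
  then show ?case
    using U by (simp add: nonprincipal_ultrafilter_def)
next
  case (insert x F)
  have "- {x} \<in> U" "- F \<in> U"
    using insert.IH U unfolding nonprincipal_ultrafilter_def by blast+
  then have "- {x} \<inter> - F \<in> U"
    using U by (simp add: nonprincipal_ultrafilter_def)
  moreover have "insert x F \<inter> (- {x} \<inter> - F) = {}"
    by auto
  ultimately show ?case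
    using U unfolding nonprincipal_ultrafilter_def by metis
qed

text \<open>A bounded function has a limit along an ultrafilter, and it stays close to the limit on
  a member of the ultrafilter.\<close>

lemma ultrafilter_oscillation:
  assumes U: "nonprincipal_ultrafilter U" and f: "f \<in> bounded_functions" and "\<epsilon> > 0"
  shows "\<exists>X\<in>U. \<forall>x\<in>X. \<forall>y\<in>X. \<bar>f x - f y\<bar> < \<epsilon>"
proof -
  have mono: "Y \<in> U" if "X \<in> U" "X \<subseteq> Y" for X Y
    using U that by (auto simp: nonprincipal_ultrafilter_def)
  have inter: "X \<inter> Y \<in> U" if "X \<in> U" "Y \<in> U" for X Y
    using U that by (simp add: nonprincipal_ultrafilter_def)
  have compl: "X \<in> U \<or> - X \<in> U" for X
    using U by (simp add: nonprincipal_ultrafilter_def)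
  have empty: "{} \<notin> U"
    using U by (simp add: nonprincipal_ultrafilter_def)
  obtain B where B: "\<And>n. \<bar>f n\<bar> \<le> B"
    using f by (auto simp: bounded_functions_iff)
  \<comment> \<open>The limit of \<open>f\<close> along \<open>U\<close> is
    \<open>Sup S\<close>.\<close>
  define S where "S = {r. {n. r < f n} \<in> U}"
  \<comment> \<open>Subtracting 1 makes the inequality strict everywhere, so \<open>S\<close> is
    nonempty.\<close>
  have "- B - 1 < f n" for n
    using B[of n] by linarith
  then have "{n. - B - 1 < f n} = - {}"
    by auto
  then have "- B - 1 \<in> S"
    using compl[of "{}"] empty by (simp add: S_def)
  have "r \<le> B" if "r \<in> S" for r
  proof (rule ccontr)
    assume "\<not> r \<le> B"
    then have "\<not> r < f n" for n
      using B[of n] by linarith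
    then show False
      using that empty by (simp add: S_def)
  qed
  then have bdd: "bdd_above S"
    by (auto simp: bdd_above_def)
  have "Sup S - \<epsilon> / 3 < Sup S"
    using \<open>\<epsilon> > 0\<close> by simp
  then obtain r where r: "r \<in> S" "Sup S - \<epsilon> / 3 < r"
    using less_cSupD[of S] \<open>- B - 1 \<in> S\<close> by blast
  have "Sup S + \<epsilon> / 3 \<notin> S"
    using cSup_upper[OF _ bdd, of "Sup S + \<epsilon> / 3"] \<open>\<epsilon> > 0\<close> by auto
  then have "- {n. Sup S + \<epsilon> / 3 < f n} \<in> U"
    using compl by (auto simp: S_def)
  then have "{n. r < f n} \<inter> - {n. Sup S + \<epsilon> / 3 < f n} \<in> U"
    using r(1) by (intro inter) (simp_all add: S_def)
  moreover have "\<bar>f x - f y\<bar> < \<epsilon>" if "r < f x" "r < f y"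
    "\<not> Sup S + \<epsilon> / 3 < f x" "\<not> Sup S + \<epsilon> / 3 < f y" for x y
    using that r(2) by linarith
  ultimately show ?thesis
    by (intro bexI) auto
qed

text \<open>Regular uncountable cardinals have uncountable cofinality: countably many proper initial
  segments cannot cover \<open>Field \<kappa>\<close>, and an index outside their union lies above
  every \<open>s k\<close>.\<close>

lemma regular_countable_bound:
  fixes \<kappa> :: "'k rel" and s :: "nat \<Rightarrow> 'k"
  assumes co: "Card_order \<kappa>" and unc: "natLeq <o \<kappa>" and reg: "regularCard \<kappa>"
    and s: "\<And>k. s k \<in> Field \<kappa>"
  shows "\<exists>i\<in>Field \<kappa>. \<forall>k. (s k, i) \<in> \<kappa>"
proof -
  have ci: "Cinfinite \<kappa>"
    using co cinfinite_mono[OF ordLess_imp_ordLeq[OF unc]] natLeq_cinfinite by simp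
  have wo: "Well_order \<kappa>"
    using co by (simp add: card_order_on_def)
  have "|\<Union>k\<in>(UNIV :: nat set). underS \<kappa> (s k)| <o \<kappa>"
  proof (rule card_of_UNION_ordLess_infinite_Field_regularCard[OF reg ci])
    show "|UNIV :: nat set| <o \<kappa>"
      using card_of_nat unc by (rule ordIso_ordLess_trans)
    show "\<forall>k\<in>UNIV. |underS \<kappa> (s k)| <o \<kappa>"
      using card_of_underS[OF co s] by simp
  qed
  moreover have "\<not> |Field \<kappa>| <o \<kappa>"
    using card_of_Field_ordIso[OF co] not_ordLess_ordIso by blast
  ultimately have "(\<Union>k. underS \<kappa> (s k)) \<noteq> Field \<kappa>"
    by auto
  moreover have "(\<Union>k. underS \<kappa> (s k)) \<subseteq> Field \<kappa>"
    by (auto simp: underS_def Field_def)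
  ultimately obtain i where i: "i \<in> Field \<kappa>" "\<And>k. i \<notin> underS \<kappa> (s k)"
    by blast
  have "(s k, i) \<in> \<kappa>" for k
  proof -
    have "(i, s k) \<in> \<kappa> \<or> (s k, i) \<in> \<kappa>"
      using wo i(1) s[of k] wo_rel.TOTALS[of \<kappa>] by (auto simp: wo_rel_def)
    moreover have "(i, i) \<in> \<kappa>"
      using wo i(1) wo_rel.REFL[of \<kappa>] by (auto simp: wo_rel_def refl_on_def)
    ultimately show ?thesis
      using i(2)[of k] by (cases "i = s k") (auto simp: underS_def)
  qed
  then show ?thesis
    using i(1) by blast
qed

section \<open>From a simple p-point to a well-ordered family of metrics\<close>

lemma almost_subset_trans: "almost_subset X Y \<Longrightarrow> almost_subset Y Z \<Longrightarrow> almost_subset X Z"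
  unfolding almost_subset_def by (rule finite_subset[of _ "(X - Y) \<union> (Y - Z)"]) auto

text \<open>The family consists of metrics \<open>collapse (T i)\<close> ordered as their indices.
  Thinning the sequence and passing to the image can only lower the cardinality, whence the bound by
  \<open>\<kappa>\<close>.\<close>

proposition st_family_of_simple_p_point:
  fixes \<kappa> :: "'k rel"
  assumes "admits_simple_p_point \<kappa>"
  shows "\<exists>D. st_family D \<and> |D| \<le>o \<kappa>"
proof -
  have co: "Card_order \<kappa>" and unc: "natLeq <o \<kappa>" and reg: "regularCard \<kappa>"
    using assms by (auto simp: admits_simple_p_point_def)
  have wo: "Well_order \<kappa>"
    using co by (simp add: card_order_on_def)
  then interpret wo_rel \<kappa>
    by (simp add: wo_rel_def)
  obtain U T where U: "nonprincipal_ultrafilter U"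
    and dec: "\<And>i j. (i, j) \<in> \<kappa> \<Longrightarrow> almost_subset (T j) (T i)"
    and gen: "generates (T ` Field \<kappa>) U"
    using assms by (auto simp: admits_simple_p_point_def simple_p_point_def)
  \<comment> \<open>Equivalent metrics would violate antisymmetry, so only the first member of each class modulo
    finite sets is kept.\<close>
  define S where "S = {i \<in> Field \<kappa>. \<forall>j. (j, i) \<in> \<kappa> \<longrightarrow> j \<noteq> i \<longrightarrow> \<not> almost_subset (T j) (T i)}"
  define D where "D = (\<lambda>i. collapse (T i)) ` S"
  have S_Field: "S \<subseteq> Field \<kappa>"
    by (auto simp: S_def)
  \<comment> \<open>If \<open>j\<close> came strictly before \<open>i\<close>, an almost inclusion
    of \<open>T j\<close> in \<open>T i\<close> would contradict that \<open>i\<close> is the first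
    index of its class.\<close>
  have le_iff: "metric_le (collapse (T i)) (collapse (T j)) \<longleftrightarrow> (i, j) \<in> \<kappa>" if "i \<in> S" "j \<in> S" for i j
  proof
    assume le: "metric_le (collapse (T i)) (collapse (T j))"
    show "(i, j) \<in> \<kappa>"
    proof (rule ccontr)
      assume "(i, j) \<notin> \<kappa>"
      moreover have "(i, j) \<in> \<kappa> \<or> (j, i) \<in> \<kappa>"
        using TOTALS that S_Field by blast
      ultimately have "(j, i) \<in> \<kappa>" "j \<noteq> i"
        by auto
      then have "\<not> almost_subset (T j) (T i)"
        using \<open>i \<in> S\<close> by (auto simp: S_def)
      then show False
        using le by (simp add: metric_le_collapse_iff)
    qed
  qed (simp add: metric_le_collapse_iff dec)
  have inj: "inj_on (\<lambda>i. collapse (T i)) S"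
  proof (rule inj_onI)
    fix i j assume ij: "i \<in> S" "j \<in> S" "collapse (T i) = collapse (T j)"
    have "metric_le (collapse (T i)) (collapse (T j))" "metric_le (collapse (T j)) (collapse (T i))"
      by (simp_all add: ij(3) metric_le_def)
    then have "(i, j) \<in> \<kappa>" "(j, i) \<in> \<kappa>"
      using le_iff ij(1,2) by simp_all
    then show "i = j"
      using ANTISYM by (auto simp: antisym_def)
  qed
  have "D \<subseteq> metrics'"
  proof -
    have "T i \<in> U" if "i \<in> S" for i
      using gen that S_Field by (auto simp: generates_def)
    then show ?thesis
      using ultrafilter_finite[OF U] collapse_in_metrics' by (auto simp: D_def)
  qed
  moreover have "well_order_on D {(d1, d2). d1 \<in> D \<and> d2 \<in> D \<and> metric_le d1 d2}"
  proof -
    \<comment> \<open>By \<open>le_iff\<close> the order on \<open>D\<close> is the well-order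
      \<open>\<kappa>\<close>, restricted to \<open>S\<close> and transported along an
      injection.\<close>
    have "{(d1, d2). d1 \<in> D \<and> d2 \<in> D \<and> metric_le d1 d2} = dir_image (Restr \<kappa> S) (\<lambda>i. collapse (T i))"
      using le_iff by (force simp: D_def dir_image_def)
    moreover have R: "Well_order (Restr \<kappa> S)" "Field (Restr \<kappa> S) = S"
      using well_order_on_Restr[OF wo S_Field] well_order_on_Well_order by blast+
    then have "Well_order (dir_image (Restr \<kappa> S) (\<lambda>i. collapse (T i)))"
      using inj by (simp add: Well_order_dir_image)
    moreover have "Field (dir_image (Restr \<kappa> S) (\<lambda>i. collapse (T i))) = D"
      by (simp add: dir_image_Field R(2) D_def)
    ultimately show ?thesis
      by simp
  qed
  moreover have "cptf_equiv stone_cech (cptf_sup (smirnov ` D))"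
  proof (rule stone_cech_equiv_sup_smirnov)
    show "D \<subseteq> metrics"
      by (auto simp: D_def collapse_in_metrics)
    show "bounded_functions \<subseteq> (\<Union>d\<in>D. bdd_unif_cont d)"
    proof
      fix f assume f: "f \<in> bounded_functions"
      have "\<exists>i\<in>Field \<kappa>. \<forall>x\<in>T i. \<forall>y\<in>T i. \<bar>f x - f y\<bar> < 1 / real (Suc k)" for k
      proof -
        obtain X where X: "X \<in> U" "\<forall>x\<in>X. \<forall>y\<in>X. \<bar>f x - f y\<bar> < 1 / real (Suc k)"
          using ultrafilter_oscillation[OF U f, of "1 / real (Suc k)"] by auto
        then obtain i where "i \<in> Field \<kappa>" "T i \<subseteq> X"
          using gen by (auto simp: generates_def)
        then show ?thesis
          using X(2) by blast
      qed
      then obtain s where s: "\<And>k. s k \<in> Field \<kappa>"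
        and osc: "\<And>k. \<forall>x\<in>T (s k). \<forall>y\<in>T (s k). \<bar>f x - f y\<bar> < 1 / real (Suc k)"
        by metis
      \<comment> \<open>One index beyond all \<open>s k\<close>: the set \<open>T i\<close> is
        almost contained in every \<open>T (s k)\<close>, so \<open>f\<close> is Cauchy along
        it.\<close>
      obtain i where i: "i \<in> Field \<kappa>" "\<And>k. (s k, i) \<in> \<kappa>"
        using regular_countable_bound[where s = s, OF co unc reg s] by blast
      \<comment> \<open>The index \<open>i\<close> may lie outside \<open>S\<close>. The first
        \<open>j\<close> with \<open>T j\<close> almost contained in \<open>T i\<close> lies in
        \<open>S\<close> by transitivity, and its set is still almost contained in every
        \<open>T (s k)\<close>.\<close>
      define j where "j = minim {j \<in> Field \<kappa>. almost_subset (T j) (T i)}"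
      have nonempty: "{j \<in> Field \<kappa>. almost_subset (T j) (T i)} \<noteq> {}"
        using i(1) by (auto simp: almost_subset_def)
      have j: "j \<in> Field \<kappa>" "almost_subset (T j) (T i)"
        using minim_in[OF _ nonempty] by (auto simp: j_def)
      have "j \<in> S"
        unfolding S_def
      proof (intro CollectI conjI allI impI notI)
        fix l assume l: "(l, j) \<in> \<kappa>" "l \<noteq> j" "almost_subset (T l) (T j)"
        then have "l \<in> {j \<in> Field \<kappa>. almost_subset (T j) (T i)}"
          using j(2) almost_subset_trans by (auto simp: Field_def)
        then have "(j, l) \<in> \<kappa>"
          unfolding j_def by (intro minim_least) auto
        then show False
          using l(1,2) ANTISYM by (auto simp: antisym_def)
      qed (rule j(1))
      moreover have "f \<in> bdd_unif_cont (collapse (T j))"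
        unfolding bdd_unif_cont_collapse_iff
      proof (intro conjI allI impI f)
        fix \<epsilon> :: real assume "\<epsilon> > 0"
        then obtain k where k: "1 / real (Suc k) < \<epsilon>"
          using nat_approx_posE by blast
        have "almost_subset (T j) (T (s k))"
          using almost_subset_trans[OF j(2) dec[OF i(2)]] .
        moreover have "\<bar>f x - f y\<bar> < \<epsilon>" if "x \<in> T (s k)" "y \<in> T (s k)" for x y
          using osc[rule_format, OF that] k by linarith
        ultimately show "\<exists>F. finite F \<and> (\<forall>x\<in>T j - F. \<forall>y\<in>T j - F. \<bar>f x - f y\<bar> < \<epsilon>)"
          by (intro exI[of _ "T j - T (s k)"]) (auto simp: almost_subset_def)
      qed
      ultimately show "f \<in> (\<Union>d\<in>D. bdd_unif_cont d)"
        by (auto simp: D_def)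
    qed
  qed
  ultimately have "st_family D"
    by (simp add: st_family_def)
  moreover have "|D| \<le>o \<kappa>"
  proof -
    have "|D| \<le>o |S|"
      unfolding D_def by (rule card_of_image)
    also have "|S| \<le>o |Field \<kappa>|"
      using S_Field by (rule card_of_mono1)
    also have "|Field \<kappa>| =o \<kappa>"
      using co by (rule card_of_Field_ordIso)
    finally show ?thesis .
  qed
  ultimately show ?thesis
    by blast
qed

section \<open>Comparison of the two least cardinals\<close>

lemma least_card_le:
  assumes "Card_order r" "P r"
  obtains m where "least_card P = Cardinal m" "P m" "m \<le>o r"
proof (rule least_card_works[where P = P, OF assms])
  fix m assume "least_card P = Cardinal m" "P m" "\<And>s. Card_order s \<Longrightarrow> P s \<Longrightarrow> m \<le>o s"
  from this(1,2) this(3)[OF assms] show thesis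
    by (rule that)
qed

theorem corollary4p2:
  shows "ext_card_le st pp"
proof (cases "\<exists>\<kappa> :: nat set rel. Card_order \<kappa> \<and> admits_simple_p_point \<kappa>")
  case True
  then obtain \<kappa> :: "nat set rel" where "Card_order \<kappa>" "admits_simple_p_point \<kappa>"
    by blast
  then obtain m where m: "pp = Cardinal m" "admits_simple_p_point m" "m \<le>o \<kappa>"
    unfolding pp_def by (rule least_card_le)
  \<comment> \<open>The minimum \<open>m\<close> is attained, so it carries a simple p-point
    itself.\<close>
  obtain D where D: "st_family D" "|D| \<le>o m"
    using st_family_of_simple_p_point[OF m(2)] by blast
  \<comment> \<open>Unlike \<open>m\<close>, the cardinal \<open>|D|\<close> is a relation on the
    type over which \<open>st\<close> minimizes; it links the two minima.\<close>
  have "\<exists>E. st_family E \<and> |D| =o |E|"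
    using D(1) ordIso_refl[OF card_of_Card_order] by blast
  then obtain n where n: "st = Cardinal n" "\<exists>E. st_family E \<and> n =o |E|" "n \<le>o |D|"
    unfolding st_def
    by (rule least_card_le[where P = "\<lambda>r. \<exists>E. st_family E \<and> r =o |E|", OF card_of_Card_order])
  show ?thesis
    using ordLeq_transitive[OF n(3) D(2)] by (simp add: m(1) n(1))
next
  case False
  \<comment> \<open>By convention infinity bounds every value of \<open>st\<close>, including
    infinity.\<close>
  then have "pp = Infinity"
    by (simp add: pp_def least_card_def)
  then show ?thesis
    by (cases st) simp_all
qed

end
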